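(* Suppose that the following property (P) holds: for all $s\in S$ and all $t<N$, $F_t(s)\subseteq V_t(s)$. Then $U_t(s)=e(V_t(s))$ for all $s\in S$ and all $t\le N$.
   Context: Setting (vector-valued Markov decision process). Integers $N\ge2$ and $m\ge1$ are fixed. $S$ is a finite set of states; for each $s\in S$, $A_s$ is a nonempty compact set of actions; $A=\bigcup_{s\in S}A_s$. For $t=1,\dots,N-1$, $s\in S$, $a\in A_s$, $R_t(s,a)\in\mathbb{R}^m$ is a vector reward, with components continuous in $a\in A_s$; $p_t(j\mid s,a)$ is the probability of state $j\in S$ at epoch $t+1$ given action $a$ in state $s$ at epoch $t$, continuous in $a\in A_s$. $R_N(s)\in\mathbb{R}^m$ is the terminal reward. A Markovian decision rule is a map $d:S\to A$ with $d(s)\in A_s$; the set $D$ of decision rules is assumed compact (topology of pointwise convergence). A (Markovian) policy is a sequence $\pi=(d_1,\dots,d_{N-1})$ of decision rules; $P_W$ is the set of all of them. Expected total rewards: $u_N^\pi(s)=R_N(s)$ and, for $t<N$, $u_t^\pi(s)=R_t(s,d_t(s))+\sum_{j\in S}p_t(j\mid s,d_t(s))\,u_{t+1}^\pi(j)$. Set $V_t(s)=\{u_t^\pi(s):\pi\in P_W\}$ for $t\le N$, $s\in S$. Order on $\mathbb{R}^m$: $x\ge y$ iff $x_i\ge y_i$ for all $i$. For $X\subseteq\mathbb{R}^m$, $e(X)=\{x\in X:\forall y\in X,\ y\ge x\Rightarrow y=x\}$. White's equations: define by backward recursion $U_N(s)=\{R_N(s)\}$ and, for $t<N$, $$F_t(s)=\bigl\{R_t(s,a)+\textstyle\sum_{j\in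 S}p_t(j\mid s,a)v_j : a\in A_s,\ v_j\in U_{t+1}(j)\ \text{for all } j\in S\bigr\},\qquad U_t(s)=e(F_t(s)).$$ *)

theory Defs
  imports "HOL-Analysis.Analysis"
begin

text \<open>
  Vector-valued Markov decision process with epochs \<open>1, \<dots>, N\<close>.  The value \<open>p t j s a\<close> stands for
  the transition probability \<open>p\<^sub>t(j | s, a)\<close>, and \<open>\<real>\<^sup>m\<close> is \<open>real^'m\<close>, whose library order
  is the componentwise one.
\<close>

text \<open>
  Decision rules are represented by extensional functions, so that functions differing only
  outside \<open>S\<close> are identified.  The topology on the function type is the product topology, i.e.
  the topology of pointwise convergence.
\<close>

definition decision_rules :: "'s set \<Rightarrow> ('s \<Rightarrow> 'a set) \<Rightarrow> ('s \<Rightarrow> 'a) set" where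
  "decision_rules S A = Pi\<^sub>E S A"

definition policies :: "nat \<Rightarrow> 's set \<Rightarrow> ('s \<Rightarrow> 'a set) \<Rightarrow> (nat \<Rightarrow> 's \<Rightarrow> 'a) set" where
  "policies N S A = {1..<N} \<rightarrow>\<^sub>E decision_rules S A"

locale vector_mdp =
  fixes N :: nat
    and S :: "'s set"
    and A :: "'s \<Rightarrow> 'a::topological_space set"
    and R :: "nat \<Rightarrow> 's \<Rightarrow> 'a \<Rightarrow> real^'m"
    and p :: "nat \<Rightarrow> 's \<Rightarrow> 's \<Rightarrow> 'a \<Rightarrow> real"
  assumes horizon: "N \<ge> 2"
    and finite_states: "finite S"
    and actions_nonempty: "\<And>s. s \<in> S \<Longrightarrow> A s \<noteq> {}"
    and actions_compact: "\<And>s. s \<in> S \<Longrightarrow> compact (A s)"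
    and rewards_continuous:
      "\<And>t s i. t \<in> {1..<N} \<Longrightarrow> s \<in> S \<Longrightarrow> continuous_on (A s) (\<lambda>a. R t s a $ i)"
    and prob_nonneg:
      "\<And>t s a j. t \<in> {1..<N} \<Longrightarrow> s \<in> S \<Longrightarrow> a \<in> A s \<Longrightarrow> j \<in> S \<Longrightarrow> p t j s a \<ge> 0"
    and prob_sum:
      "\<And>t s a. t \<in> {1..<N} \<Longrightarrow> s \<in> S \<Longrightarrow> a \<in> A s \<Longrightarrow> (\<Sum>j\<in>S. p t j s a) = 1"
    and prob_continuous:
      "\<And>t s j. t \<in> {1..<N} \<Longrightarrow> s \<in> S \<Longrightarrow> j \<in> S \<Longrightarrow> continuous_on (A s) (p t j s)"
    and decision_rules_compact: "compact (decision_rules S A)"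

text \<open>
  The backward recursions below start at epoch \<open>N\<close>; their values at epochs beyond \<open>N\<close> are
  irrelevant and set to the terminal value only for totality.
\<close>

function total_reward ::
  "nat \<Rightarrow> 's set \<Rightarrow> (nat \<Rightarrow> 's \<Rightarrow> 'a \<Rightarrow> real^'m) \<Rightarrow> (nat \<Rightarrow> 's \<Rightarrow> 's \<Rightarrow> 'a \<Rightarrow> real) \<Rightarrow> ('s \<Rightarrow> real^'m)
    \<Rightarrow> (nat \<Rightarrow> 's \<Rightarrow> 'a) \<Rightarrow> nat \<Rightarrow> 's \<Rightarrow> real^'m" where
  "total_reward N S R p RN \<pi> t s =
    (if t < N
     then R t s (\<pi> t s) + (\<Sum>j\<in>S. p t j s (\<pi> t s) *\<^sub>R total_reward N S R p RN \<pi> (t + 1) j)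
     else RN s)"
  by auto
termination
  by (relation "Wellfounded.measure (\<lambda>(N, S, R, p, RN, \<pi>, t, s). N - t)") auto

declare total_reward.simps [simp del]

definition value_set ::
  "nat \<Rightarrow> 's set \<Rightarrow> ('s \<Rightarrow> 'a set) \<Rightarrow> (nat \<Rightarrow> 's \<Rightarrow> 'a \<Rightarrow> real^'m) \<Rightarrow> (nat \<Rightarrow> 's \<Rightarrow> 's \<Rightarrow> 'a \<Rightarrow> real)
    \<Rightarrow> ('s \<Rightarrow> real^'m) \<Rightarrow> nat \<Rightarrow> 's \<Rightarrow> (real^'m) set" where
  "value_set N S A R p RN t s = {total_reward N S R p RN \<pi> t s | \<pi>. \<pi> \<in> policies N S A}"

definition efficient :: "(real^'m) set \<Rightarrow> (real^'m) set" where
  "efficient X = {x \<in> X. \<forall>y\<in>X. y \<ge> x \<longrightarrow> y = x}"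

definition one_step ::
  "'s set \<Rightarrow> ('s \<Rightarrow> 'a set) \<Rightarrow> (nat \<Rightarrow> 's \<Rightarrow> 'a \<Rightarrow> real^'m) \<Rightarrow> (nat \<Rightarrow> 's \<Rightarrow> 's \<Rightarrow> 'a \<Rightarrow> real)
    \<Rightarrow> nat \<Rightarrow> 's \<Rightarrow> ('s \<Rightarrow> (real^'m) set) \<Rightarrow> (real^'m) set" where
  "one_step S A R p t s W =
    {R t s a + (\<Sum>j\<in>S. p t j s a *\<^sub>R v j) | a v. a \<in> A s \<and> (\<forall>j\<in>S. v j \<in> W j)}"

function white_U ::
  "nat \<Rightarrow> 's set \<Rightarrow> ('s \<Rightarrow> 'a set) \<Rightarrow> (nat \<Rightarrow> 's \<Rightarrow> 'a \<Rightarrow> real^'m) \<Rightarrow> (nat \<Rightarrow> 's \<Rightarrow> 's \<Rightarrow> 'a \<Rightarrow> real)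
    \<Rightarrow> ('s \<Rightarrow> real^'m) \<Rightarrow> nat \<Rightarrow> 's \<Rightarrow> (real^'m) set" where
  "white_U N S A R p RN t s =
    (if t < N then efficient (one_step S A R p t s (\<lambda>j. white_U N S A R p RN (t + 1) j))
     else {RN s})"
  by auto
termination
  by (relation "Wellfounded.measure (\<lambda>(N, S, A, R, p, RN, t, s). N - t)") auto

declare white_U.simps [simp del]

definition white_F ::
  "nat \<Rightarrow> 's set \<Rightarrow> ('s \<Rightarrow> 'a set) \<Rightarrow> (nat \<Rightarrow> 's \<Rightarrow> 'a \<Rightarrow> real^'m) \<Rightarrow> (nat \<Rightarrow> 's \<Rightarrow> 's \<Rightarrow> 'a \<Rightarrow> real)
    \<Rightarrow> ('s \<Rightarrow> real^'m) \<Rightarrow> nat \<Rightarrow> 's \<Rightarrow> (real^'m) set" where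
  "white_F N S A R p RN t s = one_step S A R p t s (white_U N S A R p RN (t + 1))"

end

theory Submission
  imports Defs
begin

text \<open>
  The policy set is a product of compact sets, on which the expected rewards are continuous, so
  every \<open>V\<^sub>t(s)\<close> is compact and each of its points lies below an efficient one.  Replacing the
  continuation values of a policy by efficient values above them, which by induction belong to
  \<open>U\<^sub>t\<^sub>+\<^sub>1\<close>, shows that every point of \<open>V\<^sub>t(s)\<close> lies below a point of \<open>F\<^sub>t(s)\<close>.  A subset that
  dominates the whole set in this sense has the same efficient points.
\<close>

text \<open>Tychonoff's theorem for extensional functions: forcing the value
  \<open>undefined\<close> outside \<open>I\<close> is one more compact, one-point factor, so the
  set is a full product over \<open>UNIV\<close>.\<close>

lemma compact_PiE:
  fixes B :: "'i \<Rightarrow> 'b::topological_space set"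
  assumes "\<And>i. i \<in> I \<Longrightarrow> compact (B i)"
  shows "compact (Pi\<^sub>E I B)"
proof -
  let ?C = "\<lambda>i. if i \<in> I then B i else {undefined}"
  have "Pi\<^sub>E I B = Pi\<^sub>E UNIV ?C"
    by (auto simp: PiE_iff extensional_def split: if_splits)
  moreover have "compactin (product_topology (\<lambda>_. euclidean) UNIV) (Pi\<^sub>E UNIV ?C)"
    using assms by (auto simp: compactin_PiE)
  ultimately show ?thesis
    by (simp add: euclidean_product_topology)
qed

text \<open>The coordinate sum is strictly increasing in the componentwise order, so its maximiser
  among the points of \<open>X\<close> above \<open>x\<close> is efficient in all of
  \<open>X\<close>.\<close>

lemma efficient_above:
  fixes X :: "(real^'m) set"
  assumes "compact X" "x \<in> X"
  obtains y where "y \<in> efficient X" "x \<le> y"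
proof -
  let ?f = "\<lambda>y :: real^'m. \<Sum>i\<in>UNIV. y $ i"
  \<comment> \<open>The upper set of \<open>x\<close> is written as an intersection of closed
    half-spaces, which keeps \<open>?Y\<close> compact.\<close>
  let ?Y = "X \<inter> (\<Inter>i. {y. x $ i \<le> y $ i})"
  have "compact ?Y"
    by (intro compact_Int_closed assms closed_INT ballI closed_Collect_le continuous_intros)
  moreover have "?Y \<noteq> {}"
    using assms by auto
  moreover have "continuous_on ?Y ?f"
    by (intro continuous_intros)
  ultimately have "\<exists>y\<in>?Y. \<forall>z\<in>?Y. ?f z \<le> ?f y"
    by (rule continuous_attains_sup)
  then obtain y where y: "y \<in> ?Y" and max: "\<And>z. z \<in> ?Y \<Longrightarrow> ?f z \<le> ?f y"
    unfolding Ball_def Bex_def by iprover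
  have "z = y" if "z \<in> X" "y \<le> z" for z
  proof (rule ccontr)
    assume "z \<noteq> y"
    then obtain i where "y $ i < z $ i"
      using \<open>y \<le> z\<close> by (metis less_eq_vec_def order_less_le vec_eq_iff)
    then have "?f y < ?f z"
      using \<open>y \<le> z\<close> unfolding less_eq_vec_def by (intro sum_strict_mono_ex1) auto
    moreover have "z \<in> ?Y"
      using \<open>z \<in> X\<close> y order_trans[OF _ \<open>y \<le> z\<close>, of x] by (simp add: less_eq_vec_def)
    ultimately show False
      using max[of z] by linarith
  qed
  then show ?thesis
    using y by (intro that[of y]) (auto simp: efficient_def less_eq_vec_def)
qed

text \<open>If \<open>x\<close> is efficient in \<open>F\<close> and \<open>y\<close> in
  \<open>V\<close> lies above it, some \<open>f\<close> in \<open>F\<close> lies above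
  \<open>y\<close>; then \<open>f = x\<close> squeezes \<open>y\<close> to \<open>x\<close>.
  Conversely, a point efficient in \<open>V\<close> equals the point of \<open>F\<close> above
  it.\<close>

lemma efficient_eqI:
  assumes "F \<subseteq> V" and dom: "\<And>x. x \<in> V \<Longrightarrow> \<exists>f\<in>F. x \<le> f"
  shows "efficient F = efficient V"
proof
  show "efficient F \<subseteq> efficient V"
    using assms unfolding efficient_def by (auto; metis order_trans order_antisym)
  show "efficient V \<subseteq> efficient F"
    using assms unfolding efficient_def by blast
qed

lemma policiesD:
  assumes "\<pi> \<in> policies N S A" "t \<in> {1..<N}" "s \<in> S"
  shows "\<pi> t s \<in> A s"
  using assms by (auto simp: policies_def decision_rules_def PiE_iff)

context vector_mdp
begin

lemma compact_policies: "compact (policies N S A)"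
  unfolding policies_def using decision_rules_compact by (rule compact_PiE)

lemma policies_nonempty: "policies N S A \<noteq> {}"
  using actions_nonempty by (auto simp: policies_def decision_rules_def PiE_eq_empty_iff)

text \<open>Evaluation at \<open>t\<close> and then at \<open>s\<close> is a coordinate projection
  applied twice, and it sends policies into \<open>A s\<close>, where \<open>g\<close> is
  continuous.\<close>

lemma continuous_on_policy_action:
  fixes g :: "'a \<Rightarrow> 'b::topological_space"
  assumes "continuous_on (A s) g" "t \<in> {1..<N}" "s \<in> S"
  shows "continuous_on (policies N S A) (\<lambda>\<pi>. g (\<pi> t s))"
proof (rule continuous_on_compose2[OF assms(1)])
  show "continuous_on (policies N S A) (\<lambda>\<pi>. \<pi> t s)"
    by (rule continuous_on_product_then_coordinatewise[
        OF continuous_on_product_then_coordinatewise[OF continuous_on_id]])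
  show "(\<lambda>\<pi>. \<pi> t s) ` policies N S A \<subseteq> A s"
    using policiesD[OF _ assms(2,3)] by blast
qed

lemma continuous_on_reward:
  assumes "t \<in> {1..<N}" "s \<in> S"
  shows "continuous_on (A s) (R t s)"
  using continuous_on_vec_lambda[of "A s" "\<lambda>i a. R t s a $ i"] rewards_continuous[OF assms]
  by simp

lemma continuous_on_total_reward:
  assumes "s \<in> S" "1 \<le> t" "t \<le> N"
  shows "continuous_on (policies N S A) (\<lambda>\<pi>. total_reward N S R p RN \<pi> t s)"
  using assms(3,2,1)
proof (induction t arbitrary: s rule: inc_induct)
  case base
  then show ?case
    by (subst total_reward.simps) simp
next
  case (step t)
  have "t < N" "t \<in> {1..<N}"
    using step by auto
  show ?case
    using \<open>t < N\<close> step.IH step.prems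
    by (subst total_reward.simps)
      (auto intro!: continuous_intros continuous_on_policy_action[OF _ \<open>t \<in> {1..<N}\<close>]
        continuous_on_reward[OF \<open>t \<in> {1..<N}\<close>] prob_continuous[OF \<open>t \<in> {1..<N}\<close>])
qed

lemma compact_value_set:
  assumes "s \<in> S" "1 \<le> t" "t \<le> N"
  shows "compact (value_set N S A R p RN t s)"
proof -
  have "value_set N S A R p RN t s = (\<lambda>\<pi>. total_reward N S R p RN \<pi> t s) ` policies N S A"
    by (auto simp: value_set_def)
  then show ?thesis
    using compact_continuous_image[OF continuous_on_total_reward[OF assms] compact_policies]
    by simp
qed

text \<open>The action at epoch \<open>t\<close> is kept while each continuation value is raised to
  an efficient one; nonnegative probabilities preserve the inequality. The raised values may come
  from different policies for different \<open>j\<close>, so \<open>f\<close> is not claimed to be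
  the value of a single policy.\<close>

lemma value_set_below_one_step:
  assumes "s \<in> S" "t \<in> {1..<N}" "x \<in> value_set N S A R p RN t s"
  shows "\<exists>f\<in>one_step S A R p t s (\<lambda>j. efficient (value_set N S A R p RN (t + 1) j)). x \<le> f"
proof -
  obtain \<pi> where \<pi>: "\<pi> \<in> policies N S A" and x: "x = total_reward N S R p RN \<pi> t s"
    using assms(3) by (auto simp: value_set_def)
  let ?u = "total_reward N S R p RN \<pi> (t + 1)" and ?a = "\<pi> t s"
  have a: "?a \<in> A s"
    using policiesD[OF \<pi> assms(2,1)] .
  have "\<exists>y. y \<in> efficient (value_set N S A R p RN (t + 1) j) \<and> ?u j \<le> y" if "j \<in> S" for j
  proof -
    have "?u j \<in> value_set N S A R p RN (t + 1) j"
      using \<pi> by (auto simp: value_set_def)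
    moreover have "compact (value_set N S A R p RN (t + 1) j)"
      using assms(2) that by (intro compact_value_set) auto
    ultimately show ?thesis
      using efficient_above by metis
  qed
  then obtain v where v: "\<And>j. j \<in> S \<Longrightarrow> v j \<in> efficient (value_set N S A R p RN (t + 1) j)"
    and le: "\<And>j. j \<in> S \<Longrightarrow> ?u j \<le> v j"
    by metis
  let ?f = "R t s ?a + (\<Sum>j\<in>S. p t j s ?a *\<^sub>R v j)"
  have "x = R t s ?a + (\<Sum>j\<in>S. p t j s ?a *\<^sub>R ?u j)"
    using assms(2) unfolding x by (subst total_reward.simps) simp
  also have "\<dots> \<le> ?f"
    using le prob_nonneg[OF assms(2,1) a]
    by (auto simp: less_eq_vec_def intro!: sum_mono mult_left_mono)
  finally show ?thesis
    using a v by (auto simp: one_step_def)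
qed

lemma white_U_eq_efficient_value_set:
  assumes "\<And>s t. s \<in> S \<Longrightarrow> t \<in> {1..<N} \<Longrightarrow>
      white_F N S A R p RN t s \<subseteq> value_set N S A R p RN t s"
    and "s \<in> S" "1 \<le> t" "t \<le> N"
  shows "white_U N S A R p RN t s = efficient (value_set N S A R p RN t s)"
  using assms(4,3,2)
proof (induction t arbitrary: s rule: inc_induct)
  case base
  \<comment> \<open>All policies give \<open>RN s\<close> at the horizon; the existence of a policy
    excludes the empty set.\<close>
  have "value_set N S A R p RN N s = {RN s}"
    using policies_nonempty by (auto simp: value_set_def total_reward.simps)
  then show ?case
    by (auto simp: white_U.simps efficient_def)
next
  case (step t)
  have t: "t \<in> {1..<N}"
    using step by auto
  have F: "white_F N S A R p RN t s =
      one_step S A R p t s (\<lambda>j. efficient (value_set N S A R p RN (t + 1) j))"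
    using step.IH step.prems by (auto simp: white_F_def one_step_def)
  have "white_U N S A R p RN t s = efficient (white_F N S A R p RN t s)"
    using t by (subst white_U.simps) (simp add: white_F_def)
  \<comment> \<open>Property (P) supplies the inclusion of F in V, and the raised continuation
    values supply the domination.\<close>
  also have "\<dots> = efficient (value_set N S A R p RN t s)"
    using assms(1)[OF \<open>s \<in> S\<close> t] value_set_below_one_step[OF \<open>s \<in> S\<close> t] unfolding F
    by (rule efficient_eqI)
  finally show ?case .
qed

end

theorem proposition1:
  fixes N :: nat
    and S :: "'s set"
    and A :: "'s \<Rightarrow> 'a::topological_space set"
    and R :: "nat \<Rightarrow> 's \<Rightarrow> 'a \<Rightarrow> real^'m"
    and p :: "nat \<Rightarrow> 's \<Rightarrow> 's \<Rightarrow> 'a \<Rightarrow> real"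
    and RN :: "'s \<Rightarrow> real^'m"
  assumes "vector_mdp N S A R p"
    and "\<forall>s\<in>S. \<forall>t\<in>{1..<N}. white_F N S A R p RN t s \<subseteq> value_set N S A R p RN t s"
  shows "\<forall>s\<in>S. \<forall>t\<in>{1..N}. white_U N S A R p RN t s = efficient (value_set N S A R p RN t s)"
  by (intro ballI vector_mdp.white_U_eq_efficient_value_set[OF assms(1) assms(2)[rule_format]])
    auto

end
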